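(* Let $H$ be a non-coassociative bimonoid in $\mathsf{C}$. The following assertions are equivalent: (i) There exists a right codivision $r_H$ for $H$ such that $r_H=(H\otimes\rho_H)\circ\delta_H$ holds for $\rho_H=(\varepsilon_H\otimes H)\circ r_H$. (ii) There exists a right codivision $r_H$ for $H$ such that $(H\otimes\mu_H)\circ(\delta_H\otimes\rho_H)\circ\delta_H=H\otimes\eta_H$ holds for $\rho_H=(\varepsilon_H\otimes H)\circ r_H$. (iii) The non-coassociative bimonoid $H$ is a right Hopf coquasigroup.
   Context: $\mathsf{C}$ is a strict symmetric monoidal category with tensor product $\otimes$, unit object $K$ and symmetry $c$. For an object $P$ and a morphism $f$, write $P\otimes f$ for $\mathrm{id}_P\otimes f$ and $f\otimes P$ for $f\otimes \mathrm{id}_P$. A counital comagma is a triple $(D,\varepsilon_D,\delta_D)$ with $\varepsilon_D:D\to K$, $\delta_D:D\to D\otimes D$ such that $(\varepsilon_D\otimes D)\circ\delta_D=\mathrm{id}_D=(D\otimes\varepsilon_D)\circ\delta_D$ (no coassociativity required). A non-coassociative bimonoid is an object $H$ with a monoid structure $(H,\eta_H,\mu_H)$ (unital and associative) and a counital comagma structure $(H,\varepsilon_H,\delta_H)$ such that $\varepsilon_H\circ\eta_H=\mathrm{id}_K$, $\delta_H\circ\eta_H=\eta_H\otimes\eta_H$, $\varepsilon_H\circ\mu_H=\varepsilon_H\otimes\varepsilon_H$, and $\delta_H\circ\mu_H=(\mu_H\otimes\mu_H)\circ(H\otimes c_{H,H}\otimes H)\circ(\delta_H\otimes\delta_H)$.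 A right codivision of $H$ is a morphism $r_H:H\to H\otimes H$ such that $\gamma_R\circ r_H=H\otimes\eta_H=(H\otimes\mu_H)\circ(r_H\otimes H)\circ\delta_H$, where $\gamma_R=(H\otimes\mu_H)\circ(\delta_H\otimes H)$. A right Hopf coquasigroup is a non-coassociative bimonoid $H$ for which there exists a morphism $\rho_H:H\to H$ (the right antipode) such that $$(H\otimes\mu_H)\circ(\delta_H\otimes\rho_H)\circ\delta_H=H\otimes\eta_H=(H\otimes\mu_H)\circ(((H\otimes\rho_H)\circ\delta_H)\otimes H)\circ\delta_H.$$ *)

theory Defs
  imports Main
begin

text \<open>
  Categories are given by partial data over arbitrary types of objects and morphisms. The operations
  are total HOL functions, but they are only constrained on objects in \<open>Obj\<close> and on morphisms
  with matching domain and codomain; nothing is assumed about their values elsewhere.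
\<close>

record ('o, 'm) cat_struct =
  Obj :: "'o set"
  Arr :: "'m set"
  Dom :: "'m \<Rightarrow> 'o"
  Cod :: "'m \<Rightarrow> 'o"
  Id :: "'o \<Rightarrow> 'm" ("\<iota>\<index>")
  Comp :: "'m \<Rightarrow> 'm \<Rightarrow> 'm" (infixl "\<cdot>\<index>" 65)

definition Hom :: "('o, 'm, 'x) cat_struct_scheme \<Rightarrow> 'o \<Rightarrow> 'o \<Rightarrow> 'm set"
  where "Hom C X Y = {f \<in> Arr C. Dom C f = X \<and> Cod C f = Y}"

locale category =
  fixes C :: "('o, 'm, 'x) cat_struct_scheme" (structure)
  assumes Dom_Obj: "f \<in> Arr C \<Longrightarrow> Dom C f \<in> Obj C"
    and Cod_Obj: "f \<in> Arr C \<Longrightarrow> Cod C f \<in> Obj C"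
    and Id_Hom: "X \<in> Obj C \<Longrightarrow> \<iota> X \<in> Hom C X X"
    and Comp_Hom: "\<lbrakk>f \<in> Hom C X Y; g \<in> Hom C Y Z\<rbrakk> \<Longrightarrow> g \<cdot> f \<in> Hom C X Z"
    and Id_Comp: "f \<in> Hom C X Y \<Longrightarrow> \<iota> Y \<cdot> f = f"
    and Comp_Id: "f \<in> Hom C X Y \<Longrightarrow> f \<cdot> \<iota> X = f"
    and Comp_assoc: "\<lbrakk>f \<in> Hom C W X; g \<in> Hom C X Y; h \<in> Hom C Y Z\<rbrakk>
      \<Longrightarrow> (h \<cdot> g) \<cdot> f = h \<cdot> (g \<cdot> f)"

record ('o, 'm) moncat_struct = "('o, 'm) cat_struct" +
  unit_obj :: "'o" ("K\<index>")
  tensor_obj :: "'o \<Rightarrow> 'o \<Rightarrow> 'o" (infixl "\<boxtimes>\<index>" 70)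
  tensor :: "'m \<Rightarrow> 'm \<Rightarrow> 'm" (infixl "\<otimes>\<index>" 70)

locale strict_monoidal_category = category C
  for C :: "('o, 'm, 'x) moncat_struct_scheme" (structure) +
  assumes unit_Obj: "K \<in> Obj C"
    and tensor_Obj: "\<lbrakk>X \<in> Obj C; Y \<in> Obj C\<rbrakk> \<Longrightarrow> X \<boxtimes> Y \<in> Obj C"
    and tensor_Hom: "\<lbrakk>f \<in> Hom C X Y; g \<in> Hom C X' Y'\<rbrakk>
      \<Longrightarrow> f \<otimes> g \<in> Hom C (X \<boxtimes> X') (Y \<boxtimes> Y')"
    and tensor_Id: "\<lbrakk>X \<in> Obj C; Y \<in> Obj C\<rbrakk> \<Longrightarrow> \<iota> X \<otimes> \<iota> Y = \<iota> (X \<boxtimes> Y)"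
    and tensor_Comp: "\<lbrakk>f \<in> Hom C X Y; g \<in> Hom C Y Z; f' \<in> Hom C X' Y'; g' \<in> Hom C Y' Z'\<rbrakk>
      \<Longrightarrow> (g \<cdot> f) \<otimes> (g' \<cdot> f') = (g \<otimes> g') \<cdot> (f \<otimes> f')"
    and tensor_obj_assoc: "\<lbrakk>X \<in> Obj C; Y \<in> Obj C; Z \<in> Obj C\<rbrakk>
      \<Longrightarrow> (X \<boxtimes> Y) \<boxtimes> Z = X \<boxtimes> (Y \<boxtimes> Z)"
    and unit_tensor_obj: "X \<in> Obj C \<Longrightarrow> K \<boxtimes> X = X"
    and tensor_obj_unit: "X \<in> Obj C \<Longrightarrow> X \<boxtimes> K = X"
    and tensor_assoc: "\<lbrakk>f \<in> Arr C; g \<in> Arr C; h \<in> Arr C\<rbrakk> \<Longrightarrow> (f \<otimes> g) \<otimes> h = f \<otimes> (g \<otimes> h)"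
    and unit_tensor: "f \<in> Arr C \<Longrightarrow> \<iota> K \<otimes> f = f"
    and tensor_unit: "f \<in> Arr C \<Longrightarrow> f \<otimes> \<iota> K = f"

record ('o, 'm) symmoncat_struct = "('o, 'm) moncat_struct" +
  symmetry :: "'o \<Rightarrow> 'o \<Rightarrow> 'm" ("\<sigma>\<index>")

locale strict_symmetric_monoidal_category = strict_monoidal_category C
  for C :: "('o, 'm, 'x) symmoncat_struct_scheme" (structure) +
  assumes symmetry_Hom: "\<lbrakk>X \<in> Obj C; Y \<in> Obj C\<rbrakk> \<Longrightarrow> \<sigma> X Y \<in> Hom C (X \<boxtimes> Y) (Y \<boxtimes> X)"
    and symmetry_natural: "\<lbrakk>f \<in> Hom C X X'; g \<in> Hom C Y Y'\<rbrakk>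
      \<Longrightarrow> \<sigma> X' Y' \<cdot> (f \<otimes> g) = (g \<otimes> f) \<cdot> \<sigma> X Y"
    and symmetry_involutive: "\<lbrakk>X \<in> Obj C; Y \<in> Obj C\<rbrakk> \<Longrightarrow> \<sigma> Y X \<cdot> \<sigma> X Y = \<iota> (X \<boxtimes> Y)"
    and hexagon: "\<lbrakk>X \<in> Obj C; Y \<in> Obj C; Z \<in> Obj C\<rbrakk>
      \<Longrightarrow> \<sigma> X (Y \<boxtimes> Z) = (\<iota> Y \<otimes> \<sigma> X Z) \<cdot> (\<sigma> X Y \<otimes> \<iota> Z)"

locale monoid_object = strict_monoidal_category C
  for C :: "('o, 'm, 'x) moncat_struct_scheme" (structure) +
  fixes H :: 'o and \<eta> \<mu> :: 'm
  assumes monoid_Obj: "H \<in> Obj C"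
    and mon_unit_Hom: "\<eta> \<in> Hom C K H"
    and mult_Hom: "\<mu> \<in> Hom C (H \<boxtimes> H) H"
    and mult_unit_left: "\<mu> \<cdot> (\<eta> \<otimes> \<iota> H) = \<iota> H"
    and mult_unit_right: "\<mu> \<cdot> (\<iota> H \<otimes> \<eta>) = \<iota> H"
    and mult_assoc: "\<mu> \<cdot> (\<mu> \<otimes> \<iota> H) = \<mu> \<cdot> (\<iota> H \<otimes> \<mu>)"

locale counital_comagma = strict_monoidal_category C
  for C :: "('o, 'm, 'x) moncat_struct_scheme" (structure) +
  fixes D :: 'o and \<epsilon> \<delta> :: 'm
  assumes comagma_Obj: "D \<in> Obj C"
    and counit_Hom: "\<epsilon> \<in> Hom C D K"
    and comult_Hom: "\<delta> \<in> Hom C D (D \<boxtimes> D)"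
    and counit_left: "(\<epsilon> \<otimes> \<iota> D) \<cdot> \<delta> = \<iota> D"
    and counit_right: "(\<iota> D \<otimes> \<epsilon>) \<cdot> \<delta> = \<iota> D"

locale noncoassociative_bimonoid =
  strict_symmetric_monoidal_category C + monoid_object C H \<eta> \<mu> + counital_comagma C H \<epsilon> \<delta>
  for C :: "('o, 'm, 'x) symmoncat_struct_scheme" (structure) and H \<eta> \<mu> \<epsilon> \<delta> +
  assumes counit_unit: "\<epsilon> \<cdot> \<eta> = \<iota> K"
    and comult_unit: "\<delta> \<cdot> \<eta> = \<eta> \<otimes> \<eta>"
    and counit_mult: "\<epsilon> \<cdot> \<mu> = \<epsilon> \<otimes> \<epsilon>"
    and comult_mult: "\<delta> \<cdot> \<mu> = (\<mu> \<otimes> \<mu>) \<cdot> (\<iota> H \<otimes> \<sigma> H H \<otimes> \<iota> H) \<cdot> (\<delta> \<otimes> \<delta>)"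

text \<open>Below, \<open>\<iota> H \<otimes> \<eta>\<close> is a morphism from \<open>H\<close> because \<open>H \<boxtimes> K = H\<close>.\<close>

definition gamma_R :: "('o, 'm, 'x) moncat_struct_scheme \<Rightarrow> 'o \<Rightarrow> 'm \<Rightarrow> 'm \<Rightarrow> 'm"
  where "gamma_R C H \<mu> \<delta> = (\<iota> H \<otimes> \<mu>) \<cdot> (\<delta> \<otimes> \<iota> H)"
  for C (structure)

definition right_codivision ::
    "('o, 'm, 'x) moncat_struct_scheme \<Rightarrow> 'o \<Rightarrow> 'm \<Rightarrow> 'm \<Rightarrow> 'm \<Rightarrow> 'm \<Rightarrow> bool"
  where "right_codivision C H \<eta> \<mu> \<delta> r \<longleftrightarrow>
    r \<in> Hom C H (H \<boxtimes> H) \<and>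
    gamma_R C H \<mu> \<delta> \<cdot> r = \<iota> H \<otimes> \<eta> \<and>
    (\<iota> H \<otimes> \<mu>) \<cdot> (r \<otimes> \<iota> H) \<cdot> \<delta> = \<iota> H \<otimes> \<eta>"
  for C (structure)

definition right_antipode ::
    "('o, 'm, 'x) moncat_struct_scheme \<Rightarrow> 'o \<Rightarrow> 'm \<Rightarrow> 'm \<Rightarrow> 'm \<Rightarrow> 'm \<Rightarrow> bool"
  where "right_antipode C H \<eta> \<mu> \<delta> \<rho> \<longleftrightarrow>
    \<rho> \<in> Hom C H H \<and>
    (\<iota> H \<otimes> \<mu>) \<cdot> (\<delta> \<otimes> \<rho>) \<cdot> \<delta> = \<iota> H \<otimes> \<eta> \<and>
    (\<iota> H \<otimes> \<mu>) \<cdot> (((\<iota> H \<otimes> \<rho>) \<cdot> \<delta>) \<otimes> \<iota> H) \<cdot> \<delta> = \<iota> H \<otimes> \<eta>"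
  for C (structure)

definition right_Hopf_coquasigroup ::
    "('o, 'm, 'x) symmoncat_struct_scheme \<Rightarrow> 'o \<Rightarrow> 'm \<Rightarrow> 'm \<Rightarrow> 'm \<Rightarrow> 'm \<Rightarrow> bool"
  where "right_Hopf_coquasigroup C H \<eta> \<mu> \<epsilon> \<delta> \<longleftrightarrow>
    noncoassociative_bimonoid C H \<eta> \<mu> \<epsilon> \<delta> \<and> (\<exists>\<rho>. right_antipode C H \<eta> \<mu> \<delta> \<rho>)"

end

theory Submission
  imports Defs
begin

text \<open>
  Everything rests on the fact that \<open>\<gamma>\<^sub>R\<close> can be cancelled on the left as soon as \<open>H\<close>
  has a right codivision \<open>r\<close>. In fact \<open>(H \<otimes> \<mu>) \<cdot> (r \<otimes> H)\<close> is a left inverse of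
  \<open>\<gamma>\<^sub>R = (H \<otimes> \<mu>) \<cdot> (\<delta> \<otimes> H)\<close>: both morphisms are right \<open>H\<close>-linear because \<open>\<mu>\<close> is
  associative, so their composite is determined by its value on the unit of the right-hand factor,
  and that value is prescribed by the second codivision axiom
  (lemma \<open>gamma_R_left_inverse\<close>).

  Now compare \<open>r\<close> with \<open>(H \<otimes> \<rho>) \<cdot> \<delta>\<close>. Since
  \<open>\<gamma>\<^sub>R \<cdot> (H \<otimes> \<rho>) \<cdot> \<delta> = (H \<otimes> \<mu>) \<cdot> (\<delta> \<otimes> \<rho>) \<cdot> \<delta>\<close>, the first antipode axiom for \<open>\<rho>\<close> says that
  \<open>(H \<otimes> \<rho>) \<cdot> \<delta>\<close> and \<open>r\<close> have the same composite \<open>H \<otimes> \<eta>\<close> with \<open>\<gamma>\<^sub>R\<close>; by cancellation this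
  means \<open>r = (H \<otimes> \<rho>) \<cdot> \<delta>\<close>, which gives (i) \<open>\<longleftrightarrow>\<close> (ii) with the same \<open>r\<close>. Moreover, the
  codivision axioms for a morphism of the form \<open>(H \<otimes> \<rho>) \<cdot> \<delta>\<close> amount to the antipode axioms for
  \<open>\<rho>\<close>, and \<open>\<rho>\<close> is recovered from that morphism by applying the counit to its first factor.
  This gives (i) \<open>\<longleftrightarrow>\<close> (iii).
\<close>

section \<open>Whiskering in a strict monoidal category\<close>

context strict_monoidal_category
begin

lemma Hom_Arr: "f \<in> Hom C X Y \<Longrightarrow> f \<in> Arr C"
  and Hom_Dom_Obj: "f \<in> Hom C X Y \<Longrightarrow> X \<in> Obj C"
  and Hom_Cod_Obj: "f \<in> Hom C X Y \<Longrightarrow> Y \<in> Obj C"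
  using Dom_Obj Cod_Obj by (auto simp: Hom_def)

lemma tensor_left_right:
  assumes f: "f \<in> Hom C X Y" and g: "g \<in> Hom C X' Y'"
  shows "(f \<otimes> \<iota> Y') \<cdot> (\<iota> X \<otimes> g) = f \<otimes> g"
proof -
  have "(f \<cdot> \<iota> X) \<otimes> (\<iota> Y' \<cdot> g) = (f \<otimes> \<iota> Y') \<cdot> (\<iota> X \<otimes> g)"
    using tensor_Comp[OF Id_Hom[OF Hom_Dom_Obj[OF f]] f g Id_Hom[OF Hom_Cod_Obj[OF g]]] .
  then show ?thesis
    by (simp add: Comp_Id[OF f] Id_Comp[OF g])
qed

lemma tensor_right_left:
  assumes f: "f \<in> Hom C X Y" and g: "g \<in> Hom C X' Y'"
  shows "(\<iota> Y \<otimes> g) \<cdot> (f \<otimes> \<iota> X') = f \<otimes> g"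
proof -
  have "(\<iota> Y \<cdot> f) \<otimes> (g \<cdot> \<iota> X') = (\<iota> Y \<otimes> g) \<cdot> (f \<otimes> \<iota> X')"
    using tensor_Comp[OF f Id_Hom[OF Hom_Cod_Obj[OF f]] Id_Hom[OF Hom_Dom_Obj[OF g]] g] .
  then show ?thesis
    by (simp add: Comp_Id[OF g] Id_Comp[OF f])
qed

lemma whisker_left_Comp:
  assumes "f \<in> Hom C X Y" "g \<in> Hom C Y Z" "A \<in> Obj C"
  shows "\<iota> A \<otimes> (g \<cdot> f) = (\<iota> A \<otimes> g) \<cdot> (\<iota> A \<otimes> f)"
  using tensor_Comp[OF Id_Hom[OF assms(3)] Id_Hom[OF assms(3)] assms(1,2)]
    Id_Comp[OF Id_Hom[OF assms(3)]] by simp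

lemma whisker_right_Comp:
  assumes "f \<in> Hom C X Y" "g \<in> Hom C Y Z" "A \<in> Obj C"
  shows "(g \<cdot> f) \<otimes> \<iota> A = (g \<otimes> \<iota> A) \<cdot> (f \<otimes> \<iota> A)"
  using tensor_Comp[OF assms(1,2) Id_Hom[OF assms(3)] Id_Hom[OF assms(3)]]
    Id_Comp[OF Id_Hom[OF assms(3)]] by simp

end

section \<open>Morphisms of free modules over a monoid\<close>

context monoid_object
begin

lemma Id_mult_Hom: "A \<in> Obj C \<Longrightarrow> \<iota> A \<otimes> \<mu> \<in> Hom C (A \<boxtimes> H \<boxtimes> H) (A \<boxtimes> H)"
  using tensor_Hom[OF Id_Hom mult_Hom] by (simp add: tensor_obj_assoc monoid_Obj)

text \<open>
  The morphism \<open>(Y \<otimes> \<mu>) \<cdot> (f \<otimes> H) : X \<otimes> H \<rightarrow> Y \<otimes> H\<close> is the extension of \<open>f : X \<rightarrow> Y \<otimes> H\<close> to a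
  map between the free right \<open>H\<close>-modules on \<open>X\<close> and \<open>Y\<close>. Associativity of \<open>\<mu>\<close> makes such
  extensions \<open>H\<close>-linear, so a composite of two of them is the extension of its restriction to the
  generators. In other words, this is the composition law of the Kleisli category of the monad
  \<open>- \<otimes> H\<close>, and the next lemma is its unit law.
\<close>

lemma free_extension_Comp:
  assumes f: "f \<in> Hom C X (Y \<boxtimes> H)" and g: "g \<in> Hom C Y (Z \<boxtimes> H)"
    and Z: "Z \<in> Obj C"
  shows "((\<iota> Z \<otimes> \<mu>) \<cdot> (g \<otimes> \<iota> H)) \<cdot> ((\<iota> Y \<otimes> \<mu>) \<cdot> (f \<otimes> \<iota> H))
    = (\<iota> Z \<otimes> \<mu>) \<cdot> (((\<iota> Z \<otimes> \<mu>) \<cdot> (g \<otimes> \<iota> H) \<cdot> f) \<otimes> \<iota> H)"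
proof -
  note H = monoid_Obj and I = Id_Hom[OF monoid_Obj]
  have Y: "Y \<in> Obj C" using Hom_Dom_Obj[OF g] .
  note zmu = Id_mult_Hom[OF Z] and ymu = Id_mult_Hom[OF Y]
  have gI: "g \<otimes> \<iota> H \<in> Hom C (Y \<boxtimes> H) (Z \<boxtimes> H \<boxtimes> H)" using tensor_Hom[OF g I] .
  have fI: "f \<otimes> \<iota> H \<in> Hom C (X \<boxtimes> H) (Y \<boxtimes> H \<boxtimes> H)" using tensor_Hom[OF f I] .
  have gII: "(g \<otimes> \<iota> H) \<otimes> \<iota> H \<in> Hom C (Y \<boxtimes> H \<boxtimes> H) (Z \<boxtimes> H \<boxtimes> H \<boxtimes> H)"
    using tensor_Hom[OF gI I] .
  have zhmu: "\<iota> (Z \<boxtimes> H) \<otimes> \<mu> \<in> Hom C (Z \<boxtimes> H \<boxtimes> H \<boxtimes> H) (Z \<boxtimes> H \<boxtimes> H)"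
    using Id_mult_Hom[OF tensor_Obj[OF Z H]] .
  have zmuh: "(\<iota> Z \<otimes> \<mu>) \<otimes> \<iota> H \<in> Hom C (Z \<boxtimes> H \<boxtimes> H \<boxtimes> H) (Z \<boxtimes> H \<boxtimes> H)"
    using tensor_Hom[OF zmu I] .
  have slide: "(g \<otimes> \<iota> H) \<cdot> (\<iota> Y \<otimes> \<mu>) = (\<iota> (Z \<boxtimes> H) \<otimes> \<mu>) \<cdot> ((g \<otimes> \<iota> H) \<otimes> \<iota> H)"
  proof -
    have "(g \<otimes> \<iota> H) \<cdot> (\<iota> Y \<otimes> \<mu>) = (\<iota> (Z \<boxtimes> H) \<otimes> \<mu>) \<cdot> (g \<otimes> \<iota> (H \<boxtimes> H))"
      using tensor_left_right[OF g mult_Hom] tensor_right_left[OF g mult_Hom] by simp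
    then show ?thesis
      by (simp add: tensor_Id[OF H H, symmetric] tensor_assoc Hom_Arr[OF g] Hom_Arr[OF I])
  qed
  have assoc: "(\<iota> Z \<otimes> \<mu>) \<cdot> (\<iota> (Z \<boxtimes> H) \<otimes> \<mu>) = (\<iota> Z \<otimes> \<mu>) \<cdot> ((\<iota> Z \<otimes> \<mu>) \<otimes> \<iota> H)"
  proof -
    have hmu: "\<iota> H \<otimes> \<mu> \<in> Hom C (H \<boxtimes> H \<boxtimes> H) (H \<boxtimes> H)" using Id_mult_Hom[OF H] .
    have muh: "\<mu> \<otimes> \<iota> H \<in> Hom C (H \<boxtimes> H \<boxtimes> H) (H \<boxtimes> H)" using tensor_Hom[OF mult_Hom I] .
    have "(\<iota> Z \<otimes> \<mu>) \<cdot> (\<iota> Z \<otimes> (\<iota> H \<otimes> \<mu>)) = (\<iota> Z \<otimes> \<mu>) \<cdot> (\<iota> Z \<otimes> (\<mu> \<otimes> \<iota> H))"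
      using whisker_left_Comp[OF hmu mult_Hom Z] whisker_left_Comp[OF muh mult_Hom Z]
      by (simp add: mult_assoc)
    then show ?thesis
      by (simp add: tensor_Id[OF Z H, symmetric] tensor_assoc Hom_Arr[OF mult_Hom]
          Hom_Arr[OF I] Hom_Arr[OF Id_Hom[OF Z]])
  qed
  note whisker = whisker_right_Comp[OF f Comp_Hom[OF gI zmu] H] whisker_right_Comp[OF gI zmu H]
  have "((\<iota> Z \<otimes> \<mu>) \<cdot> (g \<otimes> \<iota> H)) \<cdot> ((\<iota> Y \<otimes> \<mu>) \<cdot> (f \<otimes> \<iota> H))
      = (\<iota> Z \<otimes> \<mu>) \<cdot> (((g \<otimes> \<iota> H) \<cdot> (\<iota> Y \<otimes> \<mu>)) \<cdot> (f \<otimes> \<iota> H))"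
    using Comp_assoc[OF Comp_Hom[OF fI ymu] gI zmu] Comp_assoc[OF fI ymu gI] by simp
  also have "\<dots> = ((\<iota> Z \<otimes> \<mu>) \<cdot> (\<iota> (Z \<boxtimes> H) \<otimes> \<mu>)) \<cdot> (((g \<otimes> \<iota> H) \<otimes> \<iota> H) \<cdot> (f \<otimes> \<iota> H))"
    unfolding slide
    using Comp_assoc[OF fI gII zhmu] Comp_assoc[OF Comp_Hom[OF fI gII] zhmu zmu] by simp
  also have "\<dots> = (\<iota> Z \<otimes> \<mu>) \<cdot> ((((\<iota> Z \<otimes> \<mu>) \<otimes> \<iota> H) \<cdot> ((g \<otimes> \<iota> H) \<otimes> \<iota> H)) \<cdot> (f \<otimes> \<iota> H))"
    unfolding assoc
    using Comp_assoc[OF fI gII zmuh] Comp_assoc[OF Comp_Hom[OF fI gII] zmuh zmu] by simp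
  finally show ?thesis
    by (simp add: whisker)
qed

lemma free_extension_unit:
  assumes Z: "Z \<in> Obj C"
  shows "(\<iota> Z \<otimes> \<mu>) \<cdot> ((\<iota> Z \<otimes> \<eta>) \<otimes> \<iota> H) = \<iota> (Z \<boxtimes> H)"
proof -
  note H = monoid_Obj and I = Id_Hom[OF monoid_Obj]
  have "\<eta> \<otimes> \<iota> H \<in> Hom C H (H \<boxtimes> H)"
    using tensor_Hom[OF mon_unit_Hom I] by (simp add: unit_tensor_obj[OF H])
  from whisker_left_Comp[OF this mult_Hom Z]
  have "(\<iota> Z \<otimes> \<mu>) \<cdot> (\<iota> Z \<otimes> (\<eta> \<otimes> \<iota> H)) = \<iota> Z \<otimes> \<iota> H"
    by (simp add: mult_unit_left)
  then show ?thesis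
    by (simp add: tensor_Id[OF Z H] tensor_assoc Hom_Arr[OF mon_unit_Hom] Hom_Arr[OF I]
        Hom_Arr[OF Id_Hom[OF Z]])
qed

section \<open>Codivisions and antipodes\<close>

lemma gamma_R_Hom:
  assumes "\<delta> \<in> Hom C H (H \<boxtimes> H)"
  shows "gamma_R C H \<mu> \<delta> \<in> Hom C (H \<boxtimes> H) (H \<boxtimes> H)"
  unfolding gamma_R_def
  using Comp_Hom[OF tensor_Hom[OF assms Id_Hom[OF monoid_Obj]] Id_mult_Hom[OF monoid_Obj]] .

text \<open>
  Both factors are free extensions, so the composite is the extension of the morphism
  \<open>(H \<otimes> \<mu>) \<cdot> (r \<otimes> H) \<cdot> \<delta>\<close>, and the second codivision axiom identifies the latter with
  \<open>H \<otimes> \<eta>\<close>.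
\<close>

lemma gamma_R_left_inverse:
  assumes \<delta>: "\<delta> \<in> Hom C H (H \<boxtimes> H)" and r: "right_codivision C H \<eta> \<mu> \<delta> r"
  shows "((\<iota> H \<otimes> \<mu>) \<cdot> (r \<otimes> \<iota> H)) \<cdot> gamma_R C H \<mu> \<delta> = \<iota> (H \<boxtimes> H)"
proof -
  have rH: "r \<in> Hom C H (H \<boxtimes> H)"
    and r2: "(\<iota> H \<otimes> \<mu>) \<cdot> (r \<otimes> \<iota> H) \<cdot> \<delta> = \<iota> H \<otimes> \<eta>"
    using r by (simp_all add: right_codivision_def)
  show ?thesis
    unfolding gamma_R_def free_extension_Comp[OF \<delta> rH monoid_Obj] r2
    using free_extension_unit[OF monoid_Obj] .
qed

lemma gamma_R_cancel:
  assumes \<delta>: "\<delta> \<in> Hom C H (H \<boxtimes> H)" and r: "right_codivision C H \<eta> \<mu> \<delta> r"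
    and f: "f \<in> Hom C X (H \<boxtimes> H)" and g: "g \<in> Hom C X (H \<boxtimes> H)"
    and eq: "gamma_R C H \<mu> \<delta> \<cdot> f = gamma_R C H \<mu> \<delta> \<cdot> g"
  shows "f = g"
proof -
  let ?\<beta> = "(\<iota> H \<otimes> \<mu>) \<cdot> (r \<otimes> \<iota> H)"
  have rH: "r \<in> Hom C H (H \<boxtimes> H)"
    using r by (simp add: right_codivision_def)
  have \<beta>: "?\<beta> \<in> Hom C (H \<boxtimes> H) (H \<boxtimes> H)"
    using gamma_R_Hom[OF rH] by (simp add: gamma_R_def)
  have "?\<beta> \<cdot> (gamma_R C H \<mu> \<delta> \<cdot> h) = h" if h: "h \<in> Hom C X (H \<boxtimes> H)" for h
    using Comp_assoc[OF h gamma_R_Hom[OF \<delta>] \<beta>] gamma_R_left_inverse[OF \<delta> r] Id_Comp[OF h]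
    by simp
  then show ?thesis
    using f g eq by metis
qed

lemma gamma_R_antipode_comult:
  assumes \<delta>: "\<delta> \<in> Hom C H (H \<boxtimes> H)" and \<rho>: "\<rho> \<in> Hom C H H"
  shows "gamma_R C H \<mu> \<delta> \<cdot> ((\<iota> H \<otimes> \<rho>) \<cdot> \<delta>) = (\<iota> H \<otimes> \<mu>) \<cdot> (\<delta> \<otimes> \<rho>) \<cdot> \<delta>"
proof -
  note I = Id_Hom[OF monoid_Obj]
  note \<delta>I = tensor_Hom[OF \<delta> I] and I\<rho> = tensor_Hom[OF I \<rho>] and mu = Id_mult_Hom[OF monoid_Obj]
  show ?thesis
    unfolding gamma_R_def
    using Comp_assoc[OF \<delta> I\<rho> Comp_Hom[OF \<delta>I mu]] Comp_assoc[OF I\<rho> \<delta>I mu]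
      tensor_left_right[OF \<delta> \<rho>]
    by simp
qed

lemma right_codivision_antipode_comult_iff:
  assumes \<delta>: "\<delta> \<in> Hom C H (H \<boxtimes> H)" and \<rho>: "\<rho> \<in> Hom C H H"
  shows "right_codivision C H \<eta> \<mu> \<delta> ((\<iota> H \<otimes> \<rho>) \<cdot> \<delta>) \<longleftrightarrow> right_antipode C H \<eta> \<mu> \<delta> \<rho>"
  using gamma_R_antipode_comult[OF assms] Comp_Hom[OF \<delta> tensor_Hom[OF Id_Hom[OF monoid_Obj] \<rho>]] \<rho>
  by (simp add: right_codivision_def right_antipode_def)

text \<open>
  The first antipode axiom compares the images of \<open>r\<close> and \<open>(H \<otimes> \<rho>) \<cdot> \<delta>\<close> under \<open>\<gamma>\<^sub>R\<close>, which is
  cancellable because \<open>r\<close> is a codivision.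
\<close>

lemma codivision_eq_antipode_comult_iff:
  assumes \<delta>: "\<delta> \<in> Hom C H (H \<boxtimes> H)" and r: "right_codivision C H \<eta> \<mu> \<delta> r"
    and \<rho>: "\<rho> \<in> Hom C H H"
  shows "r = (\<iota> H \<otimes> \<rho>) \<cdot> \<delta> \<longleftrightarrow> (\<iota> H \<otimes> \<mu>) \<cdot> (\<delta> \<otimes> \<rho>) \<cdot> \<delta> = \<iota> H \<otimes> \<eta>"
proof -
  have rH: "r \<in> Hom C H (H \<boxtimes> H)" and r1: "gamma_R C H \<mu> \<delta> \<cdot> r = \<iota> H \<otimes> \<eta>"
    using r by (simp_all add: right_codivision_def)
  have "(\<iota> H \<otimes> \<rho>) \<cdot> \<delta> \<in> Hom C H (H \<boxtimes> H)"
    using Comp_Hom[OF \<delta> tensor_Hom[OF Id_Hom[OF monoid_Obj] \<rho>]] .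
  then show ?thesis
    using gamma_R_cancel[OF \<delta> r rH] gamma_R_antipode_comult[OF \<delta> \<rho>] r1 by metis
qed

end

lemma (in counital_comagma) counit_left_Hom:
  assumes "r \<in> Hom C X (D \<boxtimes> Y)" "Y \<in> Obj C"
  shows "(\<epsilon> \<otimes> \<iota> Y) \<cdot> r \<in> Hom C X Y"
  using Comp_Hom[OF assms(1) tensor_Hom[OF counit_Hom Id_Hom[OF assms(2)]]]
  by (simp add: unit_tensor_obj assms(2))

lemma (in counital_comagma) counit_left_tensor_comult:
  assumes \<rho>: "\<rho> \<in> Hom C D Y"
  shows "(\<epsilon> \<otimes> \<iota> Y) \<cdot> ((\<iota> D \<otimes> \<rho>) \<cdot> \<delta>) = \<rho>"
proof -
  have Y: "Y \<in> Obj C" using Hom_Cod_Obj[OF \<rho>] .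
  note D = comagma_Obj
  note \<epsilon>Y = tensor_Hom[OF counit_Hom Id_Hom[OF Y]] and \<epsilon>D = tensor_Hom[OF counit_Hom Id_Hom[OF D]]
  note D\<rho> = tensor_Hom[OF Id_Hom[OF D] \<rho>] and K\<rho> = tensor_Hom[OF Id_Hom[OF unit_Obj] \<rho>]
  have "(\<epsilon> \<otimes> \<iota> Y) \<cdot> ((\<iota> D \<otimes> \<rho>) \<cdot> \<delta>) = (\<iota> K \<otimes> \<rho>) \<cdot> ((\<epsilon> \<otimes> \<iota> D) \<cdot> \<delta>)"
    using Comp_assoc[OF comult_Hom D\<rho> \<epsilon>Y] Comp_assoc[OF comult_Hom \<epsilon>D K\<rho>]
      tensor_left_right[OF counit_Hom \<rho>] tensor_right_left[OF counit_Hom \<rho>]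
    by simp
  also have "\<dots> = \<rho>"
    by (simp add: counit_left unit_tensor[OF Hom_Arr[OF \<rho>]] Comp_Id[OF \<rho>])
  finally show ?thesis .
qed

section \<open>Characterization of right Hopf coquasigroups\<close>

theorem theorem2p11:
  fixes C :: "('o, 'm) symmoncat_struct" (structure)
    and H :: 'o and \<eta> \<mu> \<epsilon> \<delta> :: 'm
  assumes "strict_symmetric_monoidal_category C"
    and "noncoassociative_bimonoid C H \<eta> \<mu> \<epsilon> \<delta>"
  shows
    "((\<exists>r. right_codivision C H \<eta> \<mu> \<delta> r \<and>
         (let \<rho> = (\<epsilon> \<otimes> \<iota> H) \<cdot> r in r = (\<iota> H \<otimes> \<rho>) \<cdot> \<delta>))
      \<longleftrightarrow>
      (\<exists>r. right_codivision C H \<eta> \<mu> \<delta> r \<and>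
         (let \<rho> = (\<epsilon> \<otimes> \<iota> H) \<cdot> r in (\<iota> H \<otimes> \<mu>) \<cdot> (\<delta> \<otimes> \<rho>) \<cdot> \<delta> = \<iota> H \<otimes> \<eta>)))
     \<and>
     ((\<exists>r. right_codivision C H \<eta> \<mu> \<delta> r \<and>
         (let \<rho> = (\<epsilon> \<otimes> \<iota> H) \<cdot> r in (\<iota> H \<otimes> \<mu>) \<cdot> (\<delta> \<otimes> \<rho>) \<cdot> \<delta> = \<iota> H \<otimes> \<eta>))
      \<longleftrightarrow>
      right_Hopf_coquasigroup C H \<eta> \<mu> \<epsilon> \<delta>)"
proof -
  interpret noncoassociative_bimonoid C H \<eta> \<mu> \<epsilon> \<delta> by fact
  note \<delta> = comult_Hom
  let ?\<rho> = "\<lambda>r. (\<epsilon> \<otimes> \<iota> H) \<cdot> r"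
  have \<rho>_Hom: "?\<rho> r \<in> Hom C H H" if "right_codivision C H \<eta> \<mu> \<delta> r" for r
    using that counit_left_Hom[OF _ monoid_Obj] by (simp add: right_codivision_def)
  have i_ii: "r = (\<iota> H \<otimes> ?\<rho> r) \<cdot> \<delta> \<longleftrightarrow> (\<iota> H \<otimes> \<mu>) \<cdot> (\<delta> \<otimes> ?\<rho> r) \<cdot> \<delta> = \<iota> H \<otimes> \<eta>"
    if "right_codivision C H \<eta> \<mu> \<delta> r" for r
    using codivision_eq_antipode_comult_iff[OF \<delta> that \<rho>_Hom[OF that]] .
  have i_iii: "(\<exists>r. right_codivision C H \<eta> \<mu> \<delta> r \<and> r = (\<iota> H \<otimes> ?\<rho> r) \<cdot> \<delta>)
      \<longleftrightarrow> (\<exists>\<rho>. right_antipode C H \<eta> \<mu> \<delta> \<rho>)"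
  proof
    assume "\<exists>r. right_codivision C H \<eta> \<mu> \<delta> r \<and> r = (\<iota> H \<otimes> ?\<rho> r) \<cdot> \<delta>"
    then obtain r where r: "right_codivision C H \<eta> \<mu> \<delta> r" and eq: "r = (\<iota> H \<otimes> ?\<rho> r) \<cdot> \<delta>"
      by blast
    from r have "right_codivision C H \<eta> \<mu> \<delta> ((\<iota> H \<otimes> ?\<rho> r) \<cdot> \<delta>)"
      by (subst (asm) eq)
    then show "\<exists>\<rho>. right_antipode C H \<eta> \<mu> \<delta> \<rho>"
      using right_codivision_antipode_comult_iff[OF \<delta> \<rho>_Hom[OF r]] by blast
  next
    assume "\<exists>\<rho>. right_antipode C H \<eta> \<mu> \<delta> \<rho>"
    then obtain \<rho> where \<rho>: "right_antipode C H \<eta> \<mu> \<delta> \<rho>"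
      by blast
    then have \<rho>H: "\<rho> \<in> Hom C H H"
      by (simp add: right_antipode_def)
    let ?r = "(\<iota> H \<otimes> \<rho>) \<cdot> \<delta>"
    have "right_codivision C H \<eta> \<mu> \<delta> ?r"
      using right_codivision_antipode_comult_iff[OF \<delta> \<rho>H] \<rho> by blast
    moreover have "?r = (\<iota> H \<otimes> ?\<rho> ?r) \<cdot> \<delta>"
      by (simp only: counit_left_tensor_comult[OF \<rho>H])
    ultimately show "\<exists>r. right_codivision C H \<eta> \<mu> \<delta> r \<and> r = (\<iota> H \<otimes> ?\<rho> r) \<cdot> \<delta>"
      by blast
  qed
  have "right_Hopf_coquasigroup C H \<eta> \<mu> \<epsilon> \<delta> \<longleftrightarrow> (\<exists>\<rho>. right_antipode C H \<eta> \<mu> \<delta> \<rho>)"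
    using assms(2) by (simp add: right_Hopf_coquasigroup_def)
  then show ?thesis
    unfolding Let_def using i_ii i_iii by blast
qed

end
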